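(* Let $r\geq 2$ and let $G$ be a multi $r$-edge-colored complete graph on $n$ vertices. Then at least $\big(1-\frac{r-2}{(r-1)^2}\big)\cdot n$ vertices of $G$ can be covered by $r-1$ monochromatic components of pairwise different colors, and this bound is sharp for infinitely many values of $r$. Moreover, the $r-1$ monochromatic components can be chosen so that their intersection is nonempty.
   Context: A complete graph $G$ is multi $r$-edge-colored if to each pair of distinct vertices $u,v$ a set $\emptyset\neq \mathrm{col}(uv)\subseteq [r]=\{1,\dots,r\}$ of colors is assigned, and the coloring is transitive: if $i\in \mathrm{col}(uv)\cap\mathrm{col}(vw)$ for distinct $u,v,w$, then $i\in\mathrm{col}(uw)$. The edge $uv$ has color $i$ if $i\in\mathrm{col}(uv)$. A monochromatic component of color $i$ is (the vertex set of) a connected component of the spanning subgraph of $G$ formed by the edges having color $i$ (a vertex incident to no edge of color $i$ forms a singleton component of color $i$). Sharpness means that for infinitely many $r$ there exist such $G$ in which no $r-1$ monochromatic components of pairwise different colors cover more than $\big(1-\frac{r-2}{(r-1)^2}\big)\cdot n$ vertices. *)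

theory Defs
  imports Complex_Main
begin

text \<open>
  A coloring assigns color sets to unordered pairs of vertices: the colors of the edge \<open>uv\<close>
  are \<open>col {u, v}\<close>. Values of \<open>col\<close> on any other set are irrelevant.
\<close>

definition multi_edge_colored :: "nat \<Rightarrow> 'a set \<Rightarrow> ('a set \<Rightarrow> nat set) \<Rightarrow> bool" where
  "multi_edge_colored r V col \<longleftrightarrow>
     finite V \<and> V \<noteq> {} \<and>
     (\<forall>u\<in>V. \<forall>v\<in>V. u \<noteq> v \<longrightarrow> col {u, v} \<noteq> {} \<and> col {u, v} \<subseteq> {1..r}) \<and>
     (\<forall>u\<in>V. \<forall>v\<in>V. \<forall>w\<in>V. u \<noteq> v \<and> v \<noteq> w \<and> u \<noteq> w \<longrightarrow>
        col {u, v} \<inter> col {v, w} \<subseteq> col {u, w})"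

definition color_adj :: "'a set \<Rightarrow> ('a set \<Rightarrow> nat set) \<Rightarrow> nat \<Rightarrow> ('a \<times> 'a) set" where
  "color_adj V col i = {(u, v). u \<in> V \<and> v \<in> V \<and> u \<noteq> v \<and> i \<in> col {u, v}}"

definition mono_components :: "'a set \<Rightarrow> ('a set \<Rightarrow> nat set) \<Rightarrow> nat \<Rightarrow> 'a set set" where
  "mono_components V col i = {{w. (v, w) \<in> (color_adj V col i)\<^sup>*} | v. v \<in> V}"

text \<open>
  \<open>I\<close> is the set of the \<open>r - 1\<close> colors used and \<open>C i\<close> is the component chosen in color \<open>i\<close>;
  components of different colors may coincide as vertex sets.
\<close>

definition distinct_color_components ::
  "nat \<Rightarrow> 'a set \<Rightarrow> ('a set \<Rightarrow> nat set) \<Rightarrow> nat set \<Rightarrow> (nat \<Rightarrow> 'a set) \<Rightarrow> bool" where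
  "distinct_color_components r V col I C \<longleftrightarrow>
     I \<subseteq> {1..r} \<and> card I = r - 1 \<and> (\<forall>i\<in>I. C i \<in> mono_components V col i)"

definition cover_ratio :: "nat \<Rightarrow> real" where
  "cover_ratio r = 1 - (real r - 2) / (real r - 1)\<^sup>2"

end

theory Submission
  imports Defs "HOL-Number_Theory.Cong"
begin

text \<open>
  By transitivity the components \<open>B\<^sub>i(v)\<close> of each color partition the vertex set. Let \<open>q = r - 1\<close>, and
  let \<open>U\<^sub>j(v)\<close> consist of the vertices joined to \<open>v\<close> in color \<open>j\<close> only, that is, those missed by the
  components of \<open>v\<close> in the other \<open>q\<close> colors. Suppose that \<open>\<bar>U\<^sub>j(v)\<bar> > (q - 1) n / q\<^sup>2\<close> for all \<open>j\<close> and
  \<open>v\<close>. Take a component \<open>A\<close> of color \<open>j\<close> and \<open>v \<notin> A\<close>. The other \<open>q\<close> components of \<open>v\<close> cover \<open>A\<close>, so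
  \<open>X = A \<inter> B\<^sub>i(v)\<close> has at least \<open>\<bar>A\<bar> / q\<close> elements for some \<open>i \<noteq> j\<close>. For \<open>w \<in> X\<close> the set \<open>U\<^sub>j(w)\<close> lies
  in \<open>A - X\<close>, so \<open>\<bar>U\<^sub>j(w)\<bar> \<le> (q - 1) \<bar>X\<bar>\<close> and hence \<open>\<bar>X\<bar> > n / q\<^sup>2\<close>. But \<open>X\<close> and the \<open>q + 1\<close> sets
  \<open>U\<^sub>k(w)\<close> are disjoint, and together they have more than \<open>n\<close> elements.

  Sharpness is witnessed by the affine planes of prime order \<open>p\<close>, with \<open>r = p + 1\<close> and the parallel
  classes as colors.
\<close>

section \<open>A covering bound for \<open>q + 1\<close> partitions of a finite set\<close>

lemma exists_pointed_cover:
  fixes B :: "'i \<Rightarrow> 'a \<Rightarrow> 'a set"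
  assumes "finite V" "V \<noteq> {}" "finite I" and cardI: "card I = Suc q" and "q \<ge> 1"
    and refl: "\<And>i v. i \<in> I \<Longrightarrow> v \<in> V \<Longrightarrow> v \<in> B i v"
    and class_eq: "\<And>i v w. i \<in> I \<Longrightarrow> v \<in> V \<Longrightarrow> w \<in> B i v \<Longrightarrow> B i w = B i v"
    and cover: "\<And>v. v \<in> V \<Longrightarrow> (\<Union>i\<in>I. B i v) = V"
  shows "\<exists>v\<in>V. \<exists>j\<in>I. q\<^sup>2 * card (V - (\<Union>i\<in>I - {j}. B i v)) \<le> (q - 1) * card V"
proof (rule ccontr)
  define U where "U j v = V - (\<Union>i\<in>I - {j}. B i v)" for j v
  let ?n = "card V"
  assume "\<not> ?thesis"
  then have large: "(q - 1) * ?n < q\<^sup>2 * card (U j v)" if "j \<in> I" "v \<in> V" for j v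
    using that by (force simp: U_def not_le)
  have sub: "B i v \<subseteq> V" if "i \<in> I" "v \<in> V" for i v
    using cover that by blast
  have finB: "finite (B i v)" if "i \<in> I" "v \<in> V" for i v
    using sub[OF that] \<open>finite V\<close> finite_subset by blast
  obtain v0 where v0: "v0 \<in> V" using \<open>V \<noteq> {}\<close> by blast
  obtain j where j: "j \<in> I" using cardI by fastforce
  define A where "A = B j v0"
  have cardIj: "card (I - {j}) = q" using cardI j by simp
  then have nonempty: "I - {j} \<noteq> {}" using \<open>q \<ge> 1\<close> by (metis card.empty not_one_le_zero)
  \<comment> \<open>The strict bound \<open>large\<close> makes every \<open>U i v\<close> nonempty,
    while \<open>A = V\<close> would empty \<open>U i v0\<close> for each
    \<open>i \<noteq> j\<close>.\<close>
  have "A \<noteq> V"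
  proof
    assume "A = V"
    obtain i where i: "i \<in> I - {j}" using nonempty by blast
    then have "U i v0 = {}" using \<open>A = V\<close> j by (auto simp: U_def A_def)
    then show False using large[of i v0] i v0 by simp
  qed
  then obtain v where v: "v \<in> V" "v \<notin> A" using sub[OF j v0] A_def by blast
  have "A \<subseteq> (\<Union>i\<in>I - {j}. A \<inter> B i v)"
  proof
    fix w assume w: "w \<in> A"
    then have "w \<in> V" using sub[OF j v0] A_def by blast
    then obtain i where i: "i \<in> I" "w \<in> B i v" using cover[OF v(1)] by blast
    have "i \<noteq> j"
    proof
      assume "i = j"
      then have "B j v = A"
        using class_eq[OF j v(1)] class_eq[OF j v0] i w A_def by metis
      then show False using refl[OF j v(1)] v by simp
    qed
    then show "w \<in> (\<Union>i\<in>I - {j}. A \<inter> B i v)" using i w by blast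
  qed
  then have "card A \<le> card (\<Union>i\<in>I - {j}. A \<inter> B i v)"
    using \<open>finite I\<close> finB[OF j v0] by (intro card_mono) (auto simp: A_def)
  also have "\<dots> \<le> (\<Sum>i\<in>I - {j}. card (A \<inter> B i v))"
    using \<open>finite I\<close> by (intro card_UN_le) simp
  finally have le_sum: "card A \<le> (\<Sum>i\<in>I - {j}. card (A \<inter> B i v))" .
  have "\<exists>i\<in>I - {j}. card A \<le> q * card (A \<inter> B i v)"
  proof (rule ccontr)
    assume "\<not> ?thesis"
    then have "(\<Sum>i\<in>I - {j}. q * card (A \<inter> B i v)) < (\<Sum>i\<in>I - {j}. card A)"
      using \<open>finite I\<close> nonempty by (intro sum_strict_mono) (auto simp: not_le)
    also have "\<dots> = q * card A" using cardIj by simp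
    finally show False using le_sum by (simp flip: sum_distrib_left)
  qed
  then obtain i where i: "i \<in> I" "i \<noteq> j" and iA: "card A \<le> q * card (A \<inter> B i v)" by blast
  define X where "X = A \<inter> B i v"
  have "v0 \<in> A" using refl[OF j v0] by (simp add: A_def)
  then have "card A > 0" using finB[OF j v0] by (auto simp: A_def card_gt_0_iff)
  then have "X \<noteq> {}" using iA by (auto simp: X_def)
  then obtain w where w: "w \<in> X" by blast
  have wV: "w \<in> V" using w sub[OF j v0] by (auto simp: X_def A_def)
  have Bj: "B j w = A" using w class_eq[OF j v0] by (auto simp: X_def A_def)
  have Bi: "B i w = B i v" using w class_eq[OF i(1) v(1)] by (auto simp: X_def)
  have UB: "U k w \<subseteq> B k w" for k
    using cover[OF wV] by (auto simp: U_def)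
  have finX: "finite X" using finB[OF j v0] by (simp add: X_def A_def)
  have "U j w \<subseteq> A - X"
    using UB[of j] i Bj Bi by (auto simp: U_def X_def)
  then have "card (U j w) \<le> card (A - X)"
    using finB[OF j v0] by (intro card_mono) (auto simp: A_def)
  also have "\<dots> = card A - card X"
    using finX by (intro card_Diff_subset) (auto simp: X_def)
  also have "\<dots> \<le> (q - 1) * card X"
    using iA by (simp add: X_def diff_mult_distrib)
  finally have "q\<^sup>2 * card (U j w) \<le> (q - 1) * (q\<^sup>2 * card X)"
    by (metis mult.left_commute mult_le_mono2)
  with large[OF j wV] have "(q - 1) * ?n < (q - 1) * (q\<^sup>2 * card X)" by linarith
  \<comment> \<open>Cancelling \<open>q - 1\<close> is sound: the strict inequality fails for
    \<open>q = 1\<close>, so that case is refuted here as well.\<close>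
  then have bigX: "?n < q\<^sup>2 * card X" by simp
  \<comment> \<open>\<open>X\<close> lies in both \<open>A = B j w\<close> and \<open>B i w\<close>.
    Since \<open>i \<noteq> j\<close>, each \<open>k\<close> differs from one of the two colors, so
    \<open>U k w\<close> omits one of these two sets.\<close>
  have disjX: "U k w \<inter> X = {}" if "k \<in> I" for k
  proof (cases "k = j")
    case True
    then show ?thesis using i Bi by (auto simp: U_def X_def)
  next
    case False
    then show ?thesis using j Bj by (auto simp: U_def X_def)
  qed
  have finU: "finite (U k w)" for k using \<open>finite V\<close> by (simp add: U_def)
  have "(\<Sum>k\<in>I. card (U k w)) = card (\<Union>k\<in>I. U k w)"
  proof (rule card_UN_disjoint[symmetric])
    show "\<forall>k\<in>I. \<forall>l\<in>I. k \<noteq> l \<longrightarrow> U k w \<inter> U l w = {}"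
      using UB by (fastforce simp: U_def)
  qed (use finU \<open>finite I\<close> in auto)
  also have "\<dots> + card X = card ((\<Union>k\<in>I. U k w) \<union> X)"
    using finX finU \<open>finite I\<close> disjX by (intro card_Un_disjoint[symmetric]) auto
  also have "\<dots> \<le> ?n"
    using \<open>finite V\<close> sub[OF j v0] by (intro card_mono) (auto simp: U_def X_def A_def)
  finally have total: "(\<Sum>k\<in>I. card (U k w)) + card X \<le> ?n" by simp
  have "Suc q * ((q - 1) * ?n) = (\<Sum>k\<in>I. (q - 1) * ?n)" using cardI by simp
  also have "\<dots> \<le> (\<Sum>k\<in>I. q\<^sup>2 * card (U k w))"
    using large[OF _ wV] by (intro sum_mono) (simp add: less_imp_le)
  also have "\<dots> = q\<^sup>2 * (\<Sum>k\<in>I. card (U k w))" by (simp add: sum_distrib_left)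
  finally have "Suc q * (q - 1) * ?n + q\<^sup>2 * card X \<le> q\<^sup>2 * ?n"
    using mult_le_mono2[OF total, of "q\<^sup>2"] by (simp only: distrib_left mult.assoc)
  \<comment> \<open>Since \<open>(q + 1) * (q - 1) + 1 = q\<^sup>2\<close>, the sets
    \<open>U k w\<close> leave at most \<open>n / q\<^sup>2\<close> elements for \<open>X\<close>,
    which contradicts \<open>bigX\<close>.\<close>
  moreover have "Suc q * (q - 1) * ?n + ?n = q\<^sup>2 * ?n"
    using \<open>q \<ge> 1\<close> by (cases q) (auto simp: power2_eq_square algebra_simps)
  ultimately show False using bigX by linarith
qed

section \<open>Components of a transitive coloring\<close>

text \<open>Transitivity shortcuts each path of color \<open>i\<close> to a single edge, so a
  component is a vertex together with its neighbors in that color.\<close>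

lemma component_eq:
  assumes "multi_edge_colored r V col" "v \<in> V"
  shows "{w. (v, w) \<in> (color_adj V col i)\<^sup>*} = insert v {w \<in> V. w \<noteq> v \<and> i \<in> col {v, w}}"
proof (intro subset_antisym subsetI)
  fix w assume "w \<in> {w. (v, w) \<in> (color_adj V col i)\<^sup>*}"
  then have "(v, w) \<in> (color_adj V col i)\<^sup>*" by simp
  then show "w \<in> insert v {w \<in> V. w \<noteq> v \<and> i \<in> col {v, w}}"
  proof induction
    case (step x y)
    have xy: "x \<in> V" "y \<in> V" "x \<noteq> y" "i \<in> col {x, y}"
      using step.hyps(2) by (auto simp: color_adj_def)
    \<comment> \<open>Transitivity is assumed only for three distinct vertices. If
      \<open>x = v\<close>, the last edge is already the one sought, and \<open>y = v\<close> is
      trivial.\<close>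
    have "i \<in> col {v, y}" if "x \<noteq> v" "y \<noteq> v"
    proof -
      have "col {v, x} \<inter> col {x, y} \<subseteq> col {v, y}"
        using assms xy that unfolding multi_edge_colored_def by metis
      then show ?thesis using step.IH xy that by blast
    qed
    then show ?case using xy by auto
  qed simp
next
  fix w assume "w \<in> insert v {w \<in> V. w \<noteq> v \<and> i \<in> col {v, w}}"
  then have "w = v \<or> (v, w) \<in> color_adj V col i"
    using assms(2) by (auto simp: color_adj_def)
  then show "w \<in> {w. (v, w) \<in> (color_adj V col i)\<^sup>*}" by blast
qed

lemma cover_ratio_Suc: "q \<ge> 1 \<Longrightarrow> cover_ratio (Suc q) = 1 - real (q - 1) / (real q)\<^sup>2"
  by (simp add: cover_ratio_def of_nat_diff)

text \<open>The chosen components all belong to one vertex \<open>v\<close>, which puts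
  \<open>v\<close> in their intersection; \<open>j\<close> is the omitted color.\<close>

lemma exists_large_pointed_cover:
  assumes "r \<ge> 2" and col: "multi_edge_colored r V col"
  shows "\<exists>I C. distinct_color_components r V col I C \<and>
    real (card (\<Union>i\<in>I. C i)) \<ge> cover_ratio r * real (card V) \<and> (\<Inter>i\<in>I. C i) \<noteq> {}"
proof -
  define q where "q = r - 1"
  have r: "r = Suc q" and q: "q \<ge> 1" using \<open>r \<ge> 2\<close> by (auto simp: q_def)
  define B where "B i v = {w. (v, w) \<in> (color_adj V col i)\<^sup>*}" for i v
  note B_eq = component_eq[OF col, folded B_def]
  have "finite V" "V \<noteq> {}" using col by (auto simp: multi_edge_colored_def)
  have "sym ((color_adj V col i)\<^sup>*)" for i
    by (intro sym_rtrancl symI) (auto simp: color_adj_def insert_commute)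
  then have class_eq: "B i w = B i v" if "w \<in> B i v" for i v w
    using that unfolding B_def by (auto dest: symD intro: rtrancl_trans)
  have cover: "(\<Union>i\<in>{1..r}. B i v) = V" if v: "v \<in> V" for v
  proof
    show "(\<Union>i\<in>{1..r}. B i v) \<subseteq> V" using v B_eq[OF v] by auto
    show "V \<subseteq> (\<Union>i\<in>{1..r}. B i v)"
    proof
      fix w assume w: "w \<in> V"
      show "w \<in> (\<Union>i\<in>{1..r}. B i v)"
      proof (cases "w = v")
        case True
        then show ?thesis using r by (auto simp: B_def)
      next
        case False
        then have "col {v, w} \<noteq> {}" "col {v, w} \<subseteq> {1..r}"
          using col v w unfolding multi_edge_colored_def by metis+
        then show ?thesis using False v w by (fastforce simp: B_eq)
      qed
    qed
  qed
  have "\<exists>v\<in>V. \<exists>j\<in>{1..r}. q\<^sup>2 * card (V - (\<Union>i\<in>{1..r} - {j}. B i v)) \<le> (q - 1) * card V"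
  proof (rule exists_pointed_cover)
    show "card {1..r} = Suc q" using r by simp
    show "v \<in> B i v" for i v by (simp add: B_def)
  qed (use \<open>finite V\<close> \<open>V \<noteq> {}\<close> q in \<open>simp_all only: class_eq cover finite_atLeastAtMost not_False_eq_True\<close>)
  then obtain v j where v: "v \<in> V" and j: "j \<in> {1..r}"
    and small: "q\<^sup>2 * card (V - (\<Union>i\<in>{1..r} - {j}. B i v)) \<le> (q - 1) * card V"
    by blast
  define I where "I = {1..r} - {j}"
  let ?W = "\<Union>i\<in>I. B i v"
  have WV: "?W \<subseteq> V" using cover[OF v] by (auto simp: I_def)
  have "distinct_color_components r V col I (\<lambda>i. B i v)"
    using v j by (auto simp: distinct_color_components_def mono_components_def I_def B_def)
  moreover have "real (card ?W) \<ge> cover_ratio r * real (card V)"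
  proof -
    have "card V = card ?W + card (V - ?W)"
      using card_Diff_subset[OF finite_subset[OF WV \<open>finite V\<close>] WV]
        card_mono[OF \<open>finite V\<close> WV] by linarith
    then have eq: "real (card V) = real (card ?W) + real (card (V - ?W))"
      by linarith
    have "real (q\<^sup>2 * card (V - ?W)) \<le> real ((q - 1) * card V)"
      using small unfolding I_def of_nat_le_iff .
    then have "real (card (V - ?W)) \<le> real (q - 1) / (real q)\<^sup>2 * real (card V)"
      using q by (simp add: field_simps)
    then show ?thesis using eq q by (simp add: r cover_ratio_Suc left_diff_distrib)
  qed
  moreover have "v \<in> (\<Inter>i\<in>I. B i v)" by (simp add: B_def)
  ultimately show ?thesis by blast
qed

section \<open>Affine planes of prime order\<close>

text \<open>
  The vertex \<open>v < p\<^sup>2\<close> stands for the point \<open>(v div p, v mod p)\<close> of the affine plane over the integers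
  modulo \<open>p\<close>. Color \<open>i \<le> p\<close> is the parallel class of slope \<open>- i\<close>, color \<open>p + 1\<close> that of the vertical lines.
\<close>

definition affine_line :: "nat \<Rightarrow> nat \<Rightarrow> nat \<Rightarrow> nat" where
  "affine_line p i v = (if i = Suc p then v div p else (v mod p + i * (v div p)) mod p)"

text \<open>Comparing all pairs in \<open>e\<close> avoids naming the endpoints of an unordered
  edge.\<close>

definition affine_col :: "nat \<Rightarrow> nat set \<Rightarrow> nat set" where
  "affine_col p e = {i \<in> {1..Suc p}. \<forall>u\<in>e. \<forall>v\<in>e. affine_line p i u = affine_line p i v}"

lemma affine_line_less:
  assumes "v < p\<^sup>2"
  shows "affine_line p i v < p"
proof -
  have "v < p * p" using assms by (simp add: power2_eq_square)
  moreover from this have "p > 0" by (cases p) auto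
  ultimately show ?thesis by (simp add: affine_line_def less_mult_imp_div_less)
qed

lemma eq_if_dvd_int_diff:
  assumes "int p dvd int a - int b" "a < p" "b < p"
  shows "a = b"
proof -
  have "int a mod int p = int b mod int p" using assms(1) by (simp only: mod_eq_dvd_iff)
  then show ?thesis using assms(2,3) by simp
qed

text \<open>Over the integers, equality of labels becomes a linear congruence in the coordinate
  differences; such congruences can be subtracted and solved for the slope.\<close>

lemma affine_line_eq_iff:
  assumes "i \<noteq> Suc p"
  shows "affine_line p i u = affine_line p i v \<longleftrightarrow>
    int p dvd (int (u mod p) - int (v mod p)) + int i * (int (u div p) - int (v div p))"
proof -
  have "affine_line p i u = affine_line p i v \<longleftrightarrow>
      int (u mod p + i * (u div p)) mod int p = int (v mod p + i * (v div p)) mod int p"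
    using assms unfolding affine_line_def by (simp only: if_False of_nat_eq_iff flip: of_nat_mod)
  also have "\<dots> \<longleftrightarrow> int p dvd int (u mod p + i * (u div p)) - int (v mod p + i * (v div p))"
    by (rule mod_eq_dvd_iff)
  also have "int (u mod p + i * (u div p)) - int (v mod p + i * (v div p)) =
      (int (u mod p) - int (v mod p)) + int i * (int (u div p) - int (v div p))"
    by (simp add: algebra_simps del: of_nat_mod)
  finally show ?thesis .
qed

lemma eq_if_div_mod_eq: "u div p = v div p \<Longrightarrow> u mod p = v mod p \<Longrightarrow> u = v" for u v p :: nat
  by (metis div_mult_mod_eq)

text \<open>For two non-vertical lines, subtracting the congruences eliminates \<open>?y\<close>,
  and primality of \<open>p\<close> forces the first coordinates to agree. Color \<open>i\<close> is
  kept non-vertical so that its congruence then recovers the second coordinate.\<close>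

lemma affine_line_inj_aux:
  assumes "prime p" "i \<in> {1..p}" "j \<in> {1..Suc p}" "i \<noteq> j" "u < p\<^sup>2" "v < p\<^sup>2"
    and eq: "affine_line p i u = affine_line p i v" "affine_line p j u = affine_line p j v"
  shows "u = v"
proof -
  let ?x = "int (u div p) - int (v div p)" and ?y = "int (u mod p) - int (v mod p)"
  have p: "p > 0" using \<open>prime p\<close> prime_gt_0_nat by blast
  have di: "int p dvd ?y + int i * ?x"
    using eq(1) affine_line_eq_iff[of i p u v] assms(2) by simp
  have div_eq: "u div p = v div p"
  proof (cases "j = Suc p")
    case True
    then show ?thesis using eq(2) by (simp add: affine_line_def)
  next
    case False
    then have "int p dvd ?y + int j * ?x"
      using eq(2) affine_line_eq_iff[of j p u v] by simp
    from dvd_diff[OF di this] have "int p dvd (int i - int j) * ?x"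
      by (simp add: algebra_simps)
    then consider "int p dvd int i - int j" | "int p dvd ?x"
      using \<open>prime p\<close> prime_dvd_mult_iff[of "int p"] by auto
    then show ?thesis
    proof cases
      case 1
      \<comment> \<open>Colors run from 1 to \<open>p\<close>; the shift brings them below
        \<open>p\<close>, as \<open>eq_if_dvd_int_diff\<close> demands.\<close>
      then have "int p dvd int (i - 1) - int (j - 1)"
        using assms by (simp add: of_nat_diff)
      then have "i - 1 = j - 1" using assms False by (intro eq_if_dvd_int_diff) auto
      then show ?thesis using assms by auto
    next
      case 2
      then show ?thesis
        using assms affine_line_less[of _ p "Suc p"]
        by (intro eq_if_dvd_int_diff) (auto simp: affine_line_def)
    qed
  qed
  with di have "int p dvd ?y" by simp
  then have "u mod p = v mod p" using p by (intro eq_if_dvd_int_diff) auto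
  with div_eq show ?thesis by (rule eq_if_div_mod_eq)
qed

lemma affine_line_inj:
  assumes "prime p" "i \<in> {1..Suc p}" "j \<in> {1..Suc p}" "i \<noteq> j"
  shows "inj_on (\<lambda>v. (affine_line p i v, affine_line p j v)) {..<p\<^sup>2}"
proof (rule inj_onI)
  fix u v assume uv: "u \<in> {..<p\<^sup>2}" "v \<in> {..<p\<^sup>2}"
    and "(affine_line p i u, affine_line p j u) = (affine_line p i v, affine_line p j v)"
  \<comment> \<open>Only color \<open>p + 1\<close> is vertical, so one of the two orders fits the
    auxiliary lemma.\<close>
  moreover from assms have "i \<in> {1..p} \<or> j \<in> {1..p}" by auto
  ultimately show "u = v"
    using affine_line_inj_aux[of p i j u v] affine_line_inj_aux[of p j i u v] assms by auto
qed

text \<open>An injection between sets of the same size \<open>p\<^sup>2\<close> is onto;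
  surjectivity will say that lines of different classes meet.\<close>

lemma affine_line_bij:
  assumes "prime p" "i \<in> {1..Suc p}" "j \<in> {1..Suc p}" "i \<noteq> j"
  shows "bij_betw (\<lambda>v. (affine_line p i v, affine_line p j v)) {..<p\<^sup>2} ({..<p} \<times> {..<p})"
proof -
  let ?f = "\<lambda>v. (affine_line p i v, affine_line p j v)"
  have "?f ` {..<p\<^sup>2} = {..<p} \<times> {..<p}"
    using affine_line_inj[OF assms] affine_line_less
    by (intro card_subset_eq) (auto simp: card_image power2_eq_square)
  then show ?thesis using affine_line_inj[OF assms] by (simp add: bij_betw_def)
qed

lemma affine_lines_meet:
  assumes "prime p" "i \<in> {1..Suc p}" "j \<in> {1..Suc p}" "i \<noteq> j" "a < p" "b < p"
  shows "\<exists>v<p\<^sup>2. affine_line p i v = a \<and> affine_line p j v = b"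
proof -
  have "(a, b) \<in> (\<lambda>v. (affine_line p i v, affine_line p j v)) ` {..<p\<^sup>2}"
    using affine_line_bij[OF assms(1-4)] assms(5,6) by (simp add: bij_betw_def)
  then show ?thesis by auto
qed

text \<open>A second parallel class \<open>j\<close> coordinatizes the line: each of the
  \<open>p\<close> lines of class \<open>j\<close> meets it exactly once.\<close>

lemma card_affine_line:
  assumes "prime p" "i \<in> {1..Suc p}" "a < p"
  shows "card {v. v < p\<^sup>2 \<and> affine_line p i v = a} = p"
proof -
  obtain j where j: "j \<in> {1..Suc p}" "i \<noteq> j"
    using prime_gt_0_nat[OF assms(1)] by (cases "i = 1") (auto intro: that[of 1] that[of "Suc p"])
  let ?f = "\<lambda>v. (affine_line p i v, affine_line p j v)"
  let ?L = "{v. v < p\<^sup>2 \<and> affine_line p i v = a}"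
  have inj: "inj_on ?f ?L"
    using affine_line_inj[OF assms(1,2) j] by (rule inj_on_subset) auto
  have "?f ` ?L = {a} \<times> {..<p}"
    using affine_lines_meet[OF assms(1,2) j \<open>a < p\<close>] affine_line_less by fastforce
  with card_image[OF inj] have "card ?L = card ({a} \<times> {..<p})" by simp
  then show ?thesis by simp
qed

text \<open>If the first coordinates differ, \<open>?x\<close> is invertible modulo the prime
  \<open>p\<close>, and \<open>i = - ?y / ?x\<close> solves the congruence; otherwise a vertical
  line joins the points.\<close>

lemma affine_line_through:
  assumes "prime p" "u < p\<^sup>2" "v < p\<^sup>2"
  shows "\<exists>i\<in>{1..Suc p}. affine_line p i u = affine_line p i v"
proof (cases "u div p = v div p")
  case True
  then show ?thesis by (intro bexI[of _ "Suc p"]) (auto simp: affine_line_def)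
next
  case False
  let ?x = "int (u div p) - int (v div p)" and ?y = "int (u mod p) - int (v mod p)"
  have p: "p > 0" using \<open>prime p\<close> prime_gt_0_nat by blast
  have "\<not> int p dvd ?x"
    using False assms affine_line_less[of _ p "Suc p"] eq_if_dvd_int_diff[of p "u div p" "v div p"]
    by (auto simp: affine_line_def)
  then have "coprime ?x (int p)"
    using \<open>prime p\<close> prime_imp_coprime[of "int p" ?x] by (simp add: coprime_commute)
  then obtain z where z: "[?x * z = 1] (mod int p)"
    using cong_solve_coprime_int by blast
  \<comment> \<open>The representative of the slope in \<open>{1..p}\<close>, since \<open>0\<close> is not a color.\<close>
  define i where "i = Suc (nat ((- ?y * z - 1) mod int p))"
  have "int i - 1 = (- ?y * z - 1) mod int p" using p by (simp add: i_def)
  then have "[int i - 1 = - ?y * z - 1] (mod int p)" by (simp add: cong_def)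
  then have "[int i = - ?y * z] (mod int p)"
    by (simp add: cong_iff_dvd_diff)
  then have "[?y + int i * ?x = ?y + (- ?y * z) * ?x] (mod int p)"
    by (intro cong_add cong_mult) auto
  also have "?y + (- ?y * z) * ?x = ?y - ?y * (?x * z)" by (simp add: algebra_simps)
  also have "[?y - ?y * (?x * z) = ?y - ?y * 1] (mod int p)"
    by (intro cong_diff cong_mult z) auto
  finally have d: "int p dvd ?y + int i * ?x" by (simp add: cong_0_iff)
  have "(- ?y * z - 1) mod int p < int p" using p by simp
  then have "i \<in> {1..p}" unfolding i_def using p by (simp add: nat_less_iff Suc_le_eq)
  then show ?thesis using d affine_line_eq_iff[of i p u v] by (intro bexI[of _ i]) auto
qed

section \<open>The coloring by parallel classes and sharpness\<close>

lemma affine_col_pair: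
  "affine_col p {u, v} = {i \<in> {1..Suc p}. affine_line p i u = affine_line p i v}"
  by (auto simp: affine_col_def)

lemma multi_edge_colored_affine:
  assumes "prime p"
  shows "multi_edge_colored (Suc p) {..<p\<^sup>2} (affine_col p)"
  unfolding multi_edge_colored_def affine_col_pair
proof (intro conjI ballI impI)
  fix u v assume "u \<in> {..<p\<^sup>2}" "v \<in> {..<p\<^sup>2}"
  then show "{i \<in> {1..Suc p}. affine_line p i u = affine_line p i v} \<noteq> {}"
    using affine_line_through[OF assms, of u v] by blast
next
  show "{..<p\<^sup>2} \<noteq> {}" using prime_gt_0_nat[OF assms] by (auto simp: lessThan_empty_iff)
  show "finite {..<p\<^sup>2}" by simp
next
  fix u v w
  show "{i \<in> {1..Suc p}. affine_line p i u = affine_line p i v} \<inter>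
      {i \<in> {1..Suc p}. affine_line p i v = affine_line p i w}
      \<subseteq> {i \<in> {1..Suc p}. affine_line p i u = affine_line p i w}"
    by (intro subsetI) simp
qed blast

lemma mono_components_affine:
  assumes "prime p" "i \<in> {1..Suc p}" "K \<in> mono_components {..<p\<^sup>2} (affine_col p) i"
  obtains a where "a < p" "K = {v. v < p\<^sup>2 \<and> affine_line p i v = a}"
proof -
  obtain v where v: "v < p\<^sup>2" and K: "K = {w. (v, w) \<in> (color_adj {..<p\<^sup>2} (affine_col p) i)\<^sup>*}"
    using assms(3) by (auto simp: mono_components_def)
  have "K = {w. w < p\<^sup>2 \<and> affine_line p i w = affine_line p i v}"
    unfolding K component_eq[OF multi_edge_colored_affine[OF assms(1)] lessThan_iff[THEN iffD2, OF v]]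
    using v assms(2) by (auto simp: affine_col_pair)
  with affine_line_less[OF v] show thesis by (rule that)
qed

text \<open>One line covers \<open>p\<close> points; each of the other \<open>p - 1\<close> lines
  lies in another class, hence meets it and adds at most \<open>p - 1\<close> new points.\<close>

lemma affine_cover_le:
  assumes "prime p" "distinct_color_components (Suc p) {..<p\<^sup>2} (affine_col p) I C"
  shows "card (\<Union>i\<in>I. C i) \<le> p + (p - 1) * (p - 1)"
proof -
  have I: "I \<subseteq> {1..Suc p}" "card I = p"
    and C: "\<And>i. i \<in> I \<Longrightarrow> C i \<in> mono_components {..<p\<^sup>2} (affine_col p) i"
    using assms(2) by (auto simp: distinct_color_components_def)
  have "finite I" using I(1) finite_subset by blast
  obtain i where i: "i \<in> I" using I(2) prime_gt_0_nat[OF assms(1)] by fastforce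
  have line: "\<exists>a<p. C k = {v. v < p\<^sup>2 \<and> affine_line p k v = a}" if "k \<in> I" for k
    using mono_components_affine[OF assms(1) _ C[OF that]] I(1) that by blast
  have cardC: "card (C k) = p" "finite (C k)" if "k \<in> I" for k
    using line[OF that] card_affine_line[OF assms(1)] I(1) that by auto
  have diff: "card (C k - C i) \<le> p - 1" if "k \<in> I - {i}" for k
  proof -
    have k: "k \<in> I" "k \<noteq> i" using that by auto
    obtain a where a: "a < p" "C k = {v. v < p\<^sup>2 \<and> affine_line p k v = a}"
      using line[OF k(1)] by blast
    obtain b where b: "b < p" "C i = {v. v < p\<^sup>2 \<and> affine_line p i v = b}"
      using line[OF i] by blast
    have "k \<in> {1..Suc p}" "i \<in> {1..Suc p}" using I(1) k(1) i by blast+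
    then obtain v where v: "v \<in> C k" "v \<in> C i"
      using affine_lines_meet[OF assms(1) _ _ k(2) a(1) b(1)] unfolding a(2) b(2) by blast
    then have "card (C k - C i) \<le> card (C k - {v})"
      using cardC[OF k(1)] by (intro card_mono) auto
    then show ?thesis using v cardC[OF k(1)] by simp
  qed
  have "(\<Union>k\<in>I. C k) = C i \<union> (\<Union>k\<in>I - {i}. C k - C i)" using i by blast
  then have "card (\<Union>k\<in>I. C k) \<le> card (C i) + card (\<Union>k\<in>I - {i}. C k - C i)"
    by (metis card_Un_le)
  also have "card (\<Union>k\<in>I - {i}. C k - C i) \<le> (\<Sum>k\<in>I - {i}. card (C k - C i))"
    using \<open>finite I\<close> by (intro card_UN_le) simp
  also have "\<dots> \<le> (\<Sum>k\<in>I - {i}. p - 1)" by (intro sum_mono diff)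
  also have "\<dots> = (p - 1) * (p - 1)" using I i by simp
  finally show ?thesis using cardC[OF i] by simp
qed

theorem theorem5:
  "(\<forall>r\<ge>2. \<forall>(V :: 'a set) col. multi_edge_colored r V col \<longrightarrow>
      (\<exists>I C. distinct_color_components r V col I C \<and>
             real (card (\<Union>i\<in>I. C i)) \<ge> cover_ratio r * real (card V) \<and>
             (\<Inter>i\<in>I. C i) \<noteq> {})) \<and>
   infinite {r. r \<ge> 2 \<and>
      (\<exists>(V :: nat set) col. multi_edge_colored r V col \<and>
         (\<forall>I C. distinct_color_components r V col I C \<longrightarrow>
                real (card (\<Union>i\<in>I. C i)) \<le> cover_ratio r * real (card V)))}"
  (is "_ \<and> infinite ?S")
proof (intro conjI allI impI)
  have "Suc p \<in> ?S" if p: "prime p" for p :: nat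
  proof -
    have p1: "p \<ge> 1" using prime_gt_0_nat[OF p] by simp
    have "real (card (\<Union>i\<in>I. C i)) \<le> cover_ratio (Suc p) * real (card {..<p\<^sup>2})"
      if "distinct_color_components (Suc p) {..<p\<^sup>2} (affine_col p) I C" for I C
    proof -
      have "real (card (\<Union>i\<in>I. C i)) \<le> real (p + (p - 1) * (p - 1))"
        using affine_cover_le[OF p that] by (simp only: of_nat_le_iff)
      \<comment> \<open>Both sides equal \<open>p\<^sup>2 - (p - 1)\<close>.\<close>
      also have "\<dots> = cover_ratio (Suc p) * real (card {..<p\<^sup>2})"
        using p1 by (simp add: cover_ratio_Suc of_nat_diff field_simps power2_eq_square)
      finally show ?thesis .
    qed
    with multi_edge_colored_affine[OF p] p1 show ?thesis
      by (intro CollectI conjI exI[of _ "{..<p\<^sup>2}"] exI[of _ "affine_col p"] allI impI) simp_all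
  qed
  then have "Suc ` {p. prime p} \<subseteq> ?S" by blast
  moreover have "infinite (Suc ` {p :: nat. prime p})"
    using primes_infinite by (simp add: finite_image_iff)
  ultimately show "infinite ?S" by (rule infinite_super)
qed (rule exists_large_pointed_cover)

end
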